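(* Let $r\in A$ and let $x\in S_r(0)$ be arbitrary. Then $|f'(x)|_p=1$.
   Context: $p$ is a prime, $a,b\in\mathbb{Q}_p$ with $ab\neq0$, and $\sqrt{a^2-4b}$ is assumed to exist in $\mathbb{Q}_p$. $f(x)=\frac{x^3+ax^2+bx}{ax+b}$ is considered on $\mathbb{Q}_p\setminus\{-\frac{b}{a}\}$. Let $x_1,x_2=\frac{-a\pm\sqrt{a^2-4b}}{2}\in\mathbb{Q}_p$, labelled so that $\alpha:=|x_1|_p\leq\beta:=|x_2|_p$, and $\delta=|a|_p$. (One has $\delta\leq\alpha$ if $\alpha=\beta$, and $\delta=\beta$ if $\alpha<\beta$.) Define $A=\{r:0<r<\alpha\}$ if $\delta\leq\alpha=\beta$, and $A=(0,\beta)\setminus\{\alpha\}$ if $\alpha<\beta=\delta$. $S_r(0)=\{x\in\mathbb{Q}_p:|x|_p=r\}$. *)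

theory Defs
  imports "HOL-Analysis.Analysis" "Berlekamp_Zassenhaus.Finite_Field"
begin

section \<open>The p-adic absolute value on the rationals\<close>

definition rat_padic_abs :: "nat \<Rightarrow> rat \<Rightarrow> real" where
  "rat_padic_abs p q = (if q = 0 then 0 else
     real p powi (int (multiplicity (int p) (snd (quotient_of q)))
                - int (multiplicity (int p) (fst (quotient_of q)))))"

lemma rat_padic_abs_0 [simp]: "rat_padic_abs p 0 = 0"
  by (simp add: rat_padic_abs_def)

context
  fixes p :: nat
  assumes p: "prime p"
begin

lemma rat_padic_abs_frac:
  assumes "m \<noteq> 0" "n \<noteq> 0"
  shows "rat_padic_abs p (of_int m / of_int n) =
    real p powi (int (multiplicity (int p) n) - int (multiplicity (int p) m))"
proof -
  define q where "q = (of_int m / of_int n :: rat)"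
  obtain u v where uv: "quotient_of q = (u, v)" by fastforce
  have v: "v \<noteq> 0" using quotient_of_denom_pos[OF uv] by simp
  have q: "q = of_int u / of_int v" by (rule quotient_of_div[OF uv])
  have "q \<noteq> 0" using assms by (simp add: q_def)
  hence u: "u \<noteq> 0" using q by auto
  have "(of_int (m * v) :: rat) = of_int (u * n)"
    using q assms v by (simp add: q_def field_simps)
  hence mv: "m * v = u * n" by (simp only: of_int_eq_iff)
  have "prime_elem (int p)" using p by simp
  hence "multiplicity (int p) m + multiplicity (int p) v = multiplicity (int p) u + multiplicity (int p) n"
    using mv assms u v by (metis prime_elem_multiplicity_mult_distrib)
  hence "int (multiplicity (int p) v) - int (multiplicity (int p) u) =
      int (multiplicity (int p) n) - int (multiplicity (int p) m)" by linarith
  thus ?thesis using \<open>q \<noteq> 0\<close> unfolding q_def[symmetric] by (simp add: rat_padic_abs_def uv)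
qed

lemma rat_padic_abs_pos: "q \<noteq> 0 \<Longrightarrow> rat_padic_abs p q > 0"
  using prime_gt_0_nat[OF p] by (simp add: rat_padic_abs_def)

lemma rat_padic_abs_nonneg [simp]: "rat_padic_abs p q \<ge> 0"
  using rat_padic_abs_pos[of q] by (cases "q = 0") auto

lemma rat_padic_abs_eq_0_iff [simp]: "rat_padic_abs p q = 0 \<longleftrightarrow> q = 0"
  using rat_padic_abs_pos[of q] by (cases "q = 0") auto

lemma rat_padic_abs_1 [simp]: "rat_padic_abs p 1 = 1"
  using rat_padic_abs_frac[of 1 1] by simp

lemma rat_padic_abs_mult: "rat_padic_abs p (x * y) = rat_padic_abs p x * rat_padic_abs p y"
proof (cases "x = 0 \<or> y = 0")
  case False
  obtain a b where x: "x = of_int a / of_int b" "b \<noteq> 0" "a \<noteq> 0"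
    using False by (metis quotient_of_div quotient_of_denom_pos' div_0 of_int_0 surj_pair less_irrefl snd_conv)
  obtain c d where y: "y = of_int c / of_int d" "d \<noteq> 0" "c \<noteq> 0"
    using False by (metis quotient_of_div quotient_of_denom_pos' div_0 of_int_0 surj_pair less_irrefl snd_conv)
  have xy: "x * y = of_int (a * c) / of_int (b * d)" by (simp add: x y)
  have e: "prime_elem (int p)" using p by simp
  have p0: "real p \<noteq> 0" using prime_gt_0_nat[OF p] by simp
  have "int (multiplicity (int p) (b * d)) - int (multiplicity (int p) (a * c)) =
      (int (multiplicity (int p) b) - int (multiplicity (int p) a)) +
      (int (multiplicity (int p) d) - int (multiplicity (int p) c))"
    using x y by (simp add: prime_elem_multiplicity_mult_distrib[OF e])
  moreover have "rat_padic_abs p (x * y) =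
      real p powi (int (multiplicity (int p) (b * d)) - int (multiplicity (int p) (a * c)))"
    unfolding xy using x y by (intro rat_padic_abs_frac) auto
  ultimately show ?thesis
    using x y p0 by (simp add: rat_padic_abs_frac power_int_add)
qed auto

lemma rat_padic_abs_minus [simp]: "rat_padic_abs p (- x) = rat_padic_abs p x"
proof -
  have "rat_padic_abs p (-1) * rat_padic_abs p (-1) = 1"
    by (subst rat_padic_abs_mult[symmetric]) simp
  hence "rat_padic_abs p (-1) = 1"
    using rat_padic_abs_nonneg[of "-1"] by (simp add: square_eq_1_iff)
  thus ?thesis using rat_padic_abs_mult[of "-1" x] by simp
qed

lemma rat_padic_abs_minus_commute: "rat_padic_abs p (x - y) = rat_padic_abs p (y - x)"
  using rat_padic_abs_minus[of "x - y"] by simp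

lemma rat_padic_abs_inverse: "rat_padic_abs p (inverse x) = inverse (rat_padic_abs p x)"
proof (cases "x = 0")
  case False
  have "rat_padic_abs p x * rat_padic_abs p (inverse x) = 1"
    using False by (simp flip: rat_padic_abs_mult)
  thus ?thesis by (simp add: inverse_unique)
qed auto

lemma rat_padic_abs_add_le: "rat_padic_abs p (x + y) \<le> max (rat_padic_abs p x) (rat_padic_abs p y)"
proof (cases "x = 0 \<or> y = 0 \<or> x + y = 0")
  case True
  thus ?thesis by (auto simp: le_max_iff_disj)
next
  case False
  obtain a b where x: "x = of_int a / of_int b" "b \<noteq> 0" "a \<noteq> 0"
    using False by (metis quotient_of_div quotient_of_denom_pos' div_0 of_int_0 surj_pair less_irrefl snd_conv)
  obtain c d where y: "y = of_int c / of_int d" "d \<noteq> 0" "c \<noteq> 0"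
    using False by (metis quotient_of_div quotient_of_denom_pos' div_0 of_int_0 surj_pair less_irrefl snd_conv)
  define m where "m = a * d"
  define k where "k = c * b"
  define n where "n = b * d"
  have nz: "m \<noteq> 0" "k \<noteq> 0" "n \<noteq> 0" using x y by (auto simp: m_def k_def n_def)
  have xm: "x = of_int m / of_int n" and yk: "y = of_int k / of_int n"
    using x y by (auto simp: m_def k_def n_def)
  have s: "x + y = of_int (m + k) / of_int n" by (simp add: xm yk add_divide_distrib)
  have mk: "m + k \<noteq> 0" using False s by auto
  let ?v = "multiplicity (int p)"
  have nu: "\<not> is_unit (int p)" using p by (metis not_prime_unit prime_nat_int_transfer)
  have "int p ^ min (?v m) (?v k) dvd m + k"
    by (intro dvd_add multiplicity_dvd') simp_all
  hence le: "min (?v m) (?v k) \<le> ?v (m + k)"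
    by (intro multiplicity_geI mk nu)
  have p1: "real p \<ge> 1" using prime_ge_1_nat[OF p] by simp
  have "real p powi (int (?v n) - int (?v (m + k))) \<le>
      max (real p powi (int (?v n) - int (?v m))) (real p powi (int (?v n) - int (?v k)))"
    using le p1 by (auto simp: le_max_iff_disj min_le_iff_disj intro!: power_int_increasing)
  thus ?thesis
    unfolding s using nz mk by (subst rat_padic_abs_frac) (auto simp: xm yk rat_padic_abs_frac)
qed

lemma rat_padic_abs_triangle: "rat_padic_abs p (x + y) \<le> rat_padic_abs p x + rat_padic_abs p y"
  using rat_padic_abs_add_le[of x y] rat_padic_abs_nonneg[of x] rat_padic_abs_nonneg[of y] by linarith

lemma rat_padic_abs_diff_le: "\<bar>rat_padic_abs p x - rat_padic_abs p y\<bar> \<le> rat_padic_abs p (x - y)"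
  using rat_padic_abs_triangle[of "x - y" y] rat_padic_abs_triangle[of "y - x" x]
    rat_padic_abs_minus_commute[of x y] by simp

end

section \<open>Cauchy sequences and null sequences of rationals for the p-adic absolute value\<close>

definition padic_null :: "nat \<Rightarrow> (nat \<Rightarrow> rat) \<Rightarrow> bool" where
  "padic_null p X \<longleftrightarrow> (\<lambda>n. rat_padic_abs p (X n)) \<longlonglongrightarrow> 0"

definition padic_Cauchy :: "nat \<Rightarrow> (nat \<Rightarrow> rat) \<Rightarrow> bool" where
  "padic_Cauchy p X \<longleftrightarrow> (\<forall>e>0. \<exists>N. \<forall>m\<ge>N. \<forall>n\<ge>N. rat_padic_abs p (X m - X n) < e)"

definition padic_rel :: "nat \<Rightarrow> (nat \<Rightarrow> rat) \<Rightarrow> (nat \<Rightarrow> rat) \<Rightarrow> bool" where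
  "padic_rel p X Y \<longleftrightarrow> padic_Cauchy p X \<and> padic_Cauchy p Y \<and> padic_null p (\<lambda>n. X n - Y n)"

lemma padic_null_0 [simp]: "padic_null p (\<lambda>n. 0)"
  by (simp add: padic_null_def)

lemma padic_Cauchy_const [simp]: "padic_Cauchy p (\<lambda>n. c)"
  by (simp add: padic_Cauchy_def)

context
  fixes p :: nat
  assumes p: "prime p"
begin

lemma padic_null_const [simp]: "padic_null p (\<lambda>n. c) \<longleftrightarrow> c = 0"
  by (simp add: padic_null_def LIMSEQ_const_iff p)

lemma padic_null_minus: "padic_null p X \<Longrightarrow> padic_null p (\<lambda>n. - X n)"
  by (simp add: padic_null_def p)

lemma padic_null_add:
  assumes "padic_null p X" "padic_null p Y"
  shows "padic_null p (\<lambda>n. X n + Y n)"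
proof -
  have "(\<lambda>n. rat_padic_abs p (X n) + rat_padic_abs p (Y n)) \<longlonglongrightarrow> 0"
    using assms tendsto_add[of _ 0 sequentially _ 0] by (auto simp: padic_null_def)
  thus ?thesis unfolding padic_null_def
    by (rule tendsto_sandwich[OF _ _ tendsto_const, rotated 2])
       (auto simp: p rat_padic_abs_triangle)
qed

lemma padic_null_diff:
  "padic_null p X \<Longrightarrow> padic_null p Y \<Longrightarrow> padic_null p (\<lambda>n. X n - Y n)"
  using padic_null_add[of X "\<lambda>n. - Y n"] by (simp add: padic_null_minus)

lemma padic_Cauchy_abs_convergent:
  assumes "padic_Cauchy p X"
  shows "convergent (\<lambda>n. rat_padic_abs p (X n))"
proof -
  have "Cauchy (\<lambda>n. rat_padic_abs p (X n))"
  proof (rule metric_CauchyI)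
    fix e :: real assume "e > 0"
    then obtain N where "\<forall>m\<ge>N. \<forall>n\<ge>N. rat_padic_abs p (X m - X n) < e"
      using assms unfolding padic_Cauchy_def by blast
    thus "\<exists>M. \<forall>m\<ge>M. \<forall>n\<ge>M. dist (rat_padic_abs p (X m)) (rat_padic_abs p (X n)) < e"
      unfolding dist_real_def using rat_padic_abs_diff_le[OF p] le_less_trans by blast
  qed
  thus ?thesis by (simp add: Cauchy_convergent_iff)
qed

lemma padic_Cauchy_abs_lim:
  "padic_Cauchy p X \<Longrightarrow> (\<lambda>n. rat_padic_abs p (X n)) \<longlonglongrightarrow> lim (\<lambda>n. rat_padic_abs p (X n))"
  using padic_Cauchy_abs_convergent convergent_LIMSEQ_iff by blast

lemma padic_Cauchy_bounded:
  assumes "padic_Cauchy p X"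
  obtains B where "B > 0" "\<And>n. rat_padic_abs p (X n) \<le> B"
proof -
  have "Bseq (\<lambda>n. rat_padic_abs p (X n))"
    using padic_Cauchy_abs_convergent[OF assms] by (rule convergent_imp_Bseq)
  thus ?thesis using that by (auto simp: Bseq_def p)
qed

lemma padic_null_mult:
  assumes X: "padic_Cauchy p X" and Y: "padic_null p Y"
  shows "padic_null p (\<lambda>n. X n * Y n)"
  using tendsto_mult[OF padic_Cauchy_abs_lim[OF X] Y[unfolded padic_null_def]]
  by (simp add: padic_null_def rat_padic_abs_mult[OF p])

lemma padic_Cauchy_minus: "padic_Cauchy p X \<Longrightarrow> padic_Cauchy p (\<lambda>n. - X n)"
  unfolding padic_Cauchy_def minus_diff_minus rat_padic_abs_minus[OF p] .

lemma padic_Cauchy_add: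
  assumes "padic_Cauchy p X" "padic_Cauchy p Y"
  shows "padic_Cauchy p (\<lambda>n. X n + Y n)"
  unfolding padic_Cauchy_def
proof (intro allI impI)
  fix e :: real assume e: "e > 0"
  obtain M where M: "\<And>m n. m \<ge> M \<Longrightarrow> n \<ge> M \<Longrightarrow> rat_padic_abs p (X m - X n) < e"
    using e assms unfolding padic_Cauchy_def by meson
  obtain N where N: "\<And>m n. m \<ge> N \<Longrightarrow> n \<ge> N \<Longrightarrow> rat_padic_abs p (Y m - Y n) < e"
    using e assms unfolding padic_Cauchy_def by meson
  show "\<exists>N. \<forall>m\<ge>N. \<forall>n\<ge>N. rat_padic_abs p (X m + Y m - (X n + Y n)) < e"
  proof (intro exI[of _ "max M N"] allI impI)
    fix m n assume "m \<ge> max M N" "n \<ge> max M N"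
    hence "max (rat_padic_abs p (X m - X n)) (rat_padic_abs p (Y m - Y n)) < e"
      using M[of m n] N[of m n] by simp
    thus "rat_padic_abs p (X m + Y m - (X n + Y n)) < e"
      unfolding add_diff_add using rat_padic_abs_add_le[OF p, of "X m - X n" "Y m - Y n"]
      by (rule le_less_trans[rotated])
  qed
qed

lemma padic_Cauchy_mult:
  assumes X: "padic_Cauchy p X" and Y: "padic_Cauchy p Y"
  shows "padic_Cauchy p (\<lambda>n. X n * Y n)"
  unfolding padic_Cauchy_def
proof (intro allI impI)
  fix e :: real assume e: "e > 0"
  obtain A where A: "A > 0" "\<And>n. rat_padic_abs p (X n) \<le> A" using padic_Cauchy_bounded[OF X] by blast
  obtain B where B: "B > 0" "\<And>n. rat_padic_abs p (Y n) \<le> B" using padic_Cauchy_bounded[OF Y] by blast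
  have "e / B > 0" "e / A > 0" using e A B by auto
  obtain M where M: "\<And>m n. m \<ge> M \<Longrightarrow> n \<ge> M \<Longrightarrow> rat_padic_abs p (X m - X n) < e / B"
    using \<open>e / B > 0\<close> X unfolding padic_Cauchy_def by meson
  obtain N where N: "\<And>m n. m \<ge> N \<Longrightarrow> n \<ge> N \<Longrightarrow> rat_padic_abs p (Y m - Y n) < e / A"
    using \<open>e / A > 0\<close> Y unfolding padic_Cauchy_def by meson
  show "\<exists>N. \<forall>m\<ge>N. \<forall>n\<ge>N. rat_padic_abs p (X m * Y m - X n * Y n) < e"
  proof (intro exI[of _ "max M N"] allI impI)
    fix m n assume mn: "m \<ge> max M N" "n \<ge> max M N"
    have "rat_padic_abs p (X m * (Y m - Y n)) \<le> A * rat_padic_abs p (Y m - Y n)"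
      by (simp add: rat_padic_abs_mult[OF p] A mult_right_mono p)
    also have "\<dots> < A * (e / A)" using N[of m n] mn A by (intro mult_strict_left_mono) auto
    finally have 1: "rat_padic_abs p (X m * (Y m - Y n)) < e" using A by simp
    have "rat_padic_abs p ((X m - X n) * Y n) \<le> rat_padic_abs p (X m - X n) * B"
      by (simp add: rat_padic_abs_mult[OF p] B mult_left_mono p)
    also have "\<dots> < e / B * B" using M[of m n] mn B by (intro mult_strict_right_mono) auto
    finally have 2: "rat_padic_abs p ((X m - X n) * Y n) < e" using B by simp
    show "rat_padic_abs p (X m * Y m - X n * Y n) < e"
      unfolding mult_diff_mult
      using rat_padic_abs_add_le[OF p, of "X m * (Y m - Y n)" "(X m - X n) * Y n"] 1 2 by simp
  qed
qed

lemma padic_Cauchy_not_null: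
  assumes X: "padic_Cauchy p X" and nz: "\<not> padic_null p X"
  obtains b N where "b > 0" "\<And>n. n \<ge> N \<Longrightarrow> rat_padic_abs p (X n) > b"
proof -
  define L where "L = lim (\<lambda>n. rat_padic_abs p (X n))"
  have L: "(\<lambda>n. rat_padic_abs p (X n)) \<longlonglongrightarrow> L"
    unfolding L_def by (rule padic_Cauchy_abs_lim[OF X])
  have "L \<noteq> 0" using L nz by (auto simp: padic_null_def)
  moreover have "L \<ge> 0" using L by (rule LIMSEQ_le_const) (auto simp: p)
  ultimately have "L > L / 2" "L / 2 > 0" by auto
  have "eventually (\<lambda>n. rat_padic_abs p (X n) > L / 2) sequentially"
    using order_tendstoD(1)[OF L \<open>L > L / 2\<close>] .
  thus ?thesis using that[OF \<open>L / 2 > 0\<close>] unfolding eventually_sequentially by blast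
qed

lemma padic_Cauchy_inverse:
  assumes X: "padic_Cauchy p X" and nz: "\<not> padic_null p X"
  shows "padic_Cauchy p (\<lambda>n. inverse (X n))"
  unfolding padic_Cauchy_def
proof (intro allI impI)
  fix e :: real assume e: "e > 0"
  obtain b M where b: "b > 0" and M: "\<And>n. n \<ge> M \<Longrightarrow> rat_padic_abs p (X n) > b"
    using padic_Cauchy_not_null[OF X nz] by blast
  have "e * (b * b) > 0" using e b by simp
  then obtain N where N: "\<And>m n. m \<ge> N \<Longrightarrow> n \<ge> N \<Longrightarrow> rat_padic_abs p (X m - X n) < e * (b * b)"
    using X unfolding padic_Cauchy_def by meson
  show "\<exists>N. \<forall>m\<ge>N. \<forall>n\<ge>N. rat_padic_abs p (inverse (X m) - inverse (X n)) < e"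
  proof (intro exI[of _ "max M N"] allI impI)
    fix m n assume mn: "m \<ge> max M N" "n \<ge> max M N"
    have gt: "rat_padic_abs p (X m) > b" "rat_padic_abs p (X n) > b" using M mn by auto
    hence nz: "X m \<noteq> 0" "X n \<noteq> 0" using b by auto
    have "inverse (X m) - inverse (X n) = (X n - X m) * inverse (X m * X n)"
      using nz by (simp add: field_simps)
    hence "rat_padic_abs p (inverse (X m) - inverse (X n)) =
        rat_padic_abs p (X m - X n) / (rat_padic_abs p (X m) * rat_padic_abs p (X n))"
      using rat_padic_abs_minus_commute[OF p, of "X n" "X m"]
      by (simp add: rat_padic_abs_mult[OF p] rat_padic_abs_inverse[OF p] divide_inverse)
    also have "\<dots> \<le> rat_padic_abs p (X m - X n) / (b * b)"
      using gt b by (intro divide_left_mono mult_mono mult_pos_pos) (auto simp: p)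
    also have "\<dots> < e" using N[of m n] mn b by (simp add: pos_divide_less_eq)
    finally show "rat_padic_abs p (inverse (X m) - inverse (X n)) < e" .
  qed
qed

lemma padic_null_diff_inverse:
  assumes X: "padic_Cauchy p X" "\<not> padic_null p X"
    and Y: "padic_Cauchy p Y" "\<not> padic_null p Y"
    and XY: "padic_null p (\<lambda>n. X n - Y n)"
  shows "padic_null p (\<lambda>n. inverse (X n) - inverse (Y n))"
proof -
  obtain b M where b: "b > 0" and M: "\<And>n. n \<ge> M \<Longrightarrow> rat_padic_abs p (X n) > b"
    using padic_Cauchy_not_null[OF X] by blast
  obtain c N where c: "c > 0" and N: "\<And>n. n \<ge> N \<Longrightarrow> rat_padic_abs p (Y n) > c"
    using padic_Cauchy_not_null[OF Y] by blast
  have "padic_null p (\<lambda>n. - (inverse (X n) * inverse (Y n)) * (X n - Y n))"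
    by (intro padic_null_mult padic_Cauchy_minus padic_Cauchy_mult padic_Cauchy_inverse assms)
  moreover have "eventually (\<lambda>n. - (inverse (X n) * inverse (Y n)) * (X n - Y n) =
      inverse (X n) - inverse (Y n)) sequentially"
    unfolding eventually_sequentially
  proof (intro exI[of _ "max M N"] allI impI)
    fix n assume "n \<ge> max M N"
    hence "X n \<noteq> 0" "Y n \<noteq> 0" using M[of n] N[of n] b c by auto
    thus "- (inverse (X n) * inverse (Y n)) * (X n - Y n) = inverse (X n) - inverse (Y n)"
      by (simp add: field_simps)
  qed
  ultimately show ?thesis
    unfolding padic_null_def
    by (elim Lim_transform_eventually) (auto elim: eventually_mono)
qed

lemma padic_rel_part_equivp: "part_equivp (padic_rel p)"
proof (rule part_equivpI)
  show "\<exists>x. padic_rel p x x" by (rule exI[of _ "\<lambda>n. 0"]) (simp add: padic_rel_def)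
  show "symp (padic_rel p)"
  proof (rule sympI)
    fix X Y assume "padic_rel p X Y"
    thus "padic_rel p Y X"
      using padic_null_minus[of "\<lambda>n. X n - Y n"] by (simp add: padic_rel_def)
  qed
  show "transp (padic_rel p)"
  proof (rule transpI)
    fix X Y Z assume "padic_rel p X Y" "padic_rel p Y Z"
    thus "padic_rel p X Z"
      using padic_null_add[of "\<lambda>n. X n - Y n" "\<lambda>n. Y n - Z n"] by (simp add: padic_rel_def)
  qed
qed

lemma padic_rel_null_iff:
  assumes "padic_rel p X Y"
  shows "padic_null p X \<longleftrightarrow> padic_null p Y"
  using assms padic_null_diff[of X "\<lambda>n. X n - Y n"] padic_null_add[of "\<lambda>n. X n - Y n" Y]
  by (auto simp: padic_rel_def)

lemma padic_rel_lim:
  assumes "padic_rel p X Y"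
  shows "lim (\<lambda>n. rat_padic_abs p (X n)) = lim (\<lambda>n. rat_padic_abs p (Y n))"
proof -
  have "(\<lambda>n. rat_padic_abs p (X n - Y n)) \<longlonglongrightarrow> 0"
    using assms by (simp add: padic_rel_def padic_null_def)
  hence 0: "(\<lambda>n. rat_padic_abs p (X n) - rat_padic_abs p (Y n)) \<longlonglongrightarrow> 0"
    by (rule Lim_null_comparison[rotated]) (simp add: rat_padic_abs_diff_le[OF p])
  have "(\<lambda>n. rat_padic_abs p (X n) - rat_padic_abs p (Y n)) \<longlonglongrightarrow>
      lim (\<lambda>n. rat_padic_abs p (X n)) - lim (\<lambda>n. rat_padic_abs p (Y n))"
    using assms unfolding padic_rel_def by (intro tendsto_diff padic_Cauchy_abs_lim) auto
  from LIMSEQ_unique[OF this 0] show ?thesis by simp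
qed

end

section \<open>The field of p-adic numbers\<close>

text \<open>
  The type \<open>'p padic\<close> is the field of p-adic numbers for the prime \<open>p = CARD('p)\<close>: the completion
  of the rationals with respect to the p-adic absolute value.
\<close>

typedef (overloaded) ('p::prime_card) padic =
  "{{Y. padic_rel CARD('p) X Y} | X. padic_rel CARD('p) X X}"
  morphisms padic_class Abs_padic
  using padic_rel_part_equivp[OF prime_card] by (auto simp: part_equivp_def)

definition Padic :: "(nat \<Rightarrow> rat) \<Rightarrow> 'p::prime_card padic" where
  "Padic X = Abs_padic {Y. padic_rel CARD('p) X Y}"

definition rep_padic :: "'p::prime_card padic \<Rightarrow> nat \<Rightarrow> rat" where
  "rep_padic x = (SOME X. X \<in> padic_class x)"

definition cr_padic :: "(nat \<Rightarrow> rat) \<Rightarrow> 'p::prime_card padic \<Rightarrow> bool" where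
  "cr_padic X x \<longleftrightarrow> padic_rel CARD('p) X X \<and> Padic X = x"

lemma padic_class_Padic:
  assumes "padic_rel CARD('p::prime_card) X X"
  shows "padic_class (Padic X :: 'p padic) = {Y. padic_rel CARD('p) X Y}"
  unfolding Padic_def using assms by (intro Abs_padic_inverse) auto

lemma Quotient_padic:
  "Quotient (padic_rel CARD('p::prime_card)) Padic rep_padic (cr_padic :: _ \<Rightarrow> 'p padic \<Rightarrow> bool)"
proof -
  let ?R = "padic_rel CARD('p)"
  have pe: "part_equivp ?R" by (rule padic_rel_part_equivp[OF prime_card])
  have sym: "?R Y X" if "?R X Y" for X Y using part_equivp_symp[OF pe] that by blast
  have tr: "?R X Z" if "?R X Y" "?R Y Z" for X Y Z using part_equivp_transp[OF pe] that by blast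
  have rep: "?R (rep_padic x) (rep_padic x) \<and> Padic (rep_padic x) = x" for x :: "'p padic"
  proof -
    obtain X where X: "?R X X" "padic_class x = {Y. ?R X Y}"
      using padic_class[of x] by auto
    hence "?R X (rep_padic x)"
      unfolding rep_padic_def by (metis (mono_tags, lifting) mem_Collect_eq someI_ex)
    moreover from this have "{Y. ?R (rep_padic x) Y} = padic_class x"
      unfolding X using sym tr by blast
    ultimately show ?thesis
      using sym tr unfolding Padic_def by (metis padic_class_inverse)
  qed
  have eq: "Padic X = (Padic Y :: 'p padic) \<longleftrightarrow> ?R X Y" if "?R X X" "?R Y Y" for X Y
  proof
    assume "Padic X = (Padic Y :: 'p padic)"
    hence "{Z. ?R X Z} = {Z. ?R Y Z}"
      using padic_class_Padic[OF that(1)] padic_class_Padic[OF that(2)] by metis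
    thus "?R X Y" using that(2) by blast
  next
    assume "?R X Y"
    hence "{Z. ?R X Z} = {Z. ?R Y Z}" using sym tr by blast
    thus "Padic X = (Padic Y :: 'p padic)" by (simp add: Padic_def)
  qed
  show ?thesis
    unfolding Quotient_def
  proof (intro conjI allI)
    fix X Y
    show "?R X Y \<longleftrightarrow> ?R X X \<and> ?R Y Y \<and> Padic X = (Padic Y :: 'p padic)"
      using eq sym tr by blast
  qed (use rep in \<open>auto simp: cr_padic_def fun_eq_iff\<close>)
qed

setup_lifting Quotient_padic

lemma cr_padic_eq: "pcr_padic = (\<lambda>X x. padic_Cauchy CARD('p) X \<and> Padic X = (x :: 'p::prime_card padic))"
  by (simp add: padic.pcr_cr_eq cr_padic_def padic_rel_def fun_eq_iff)

lemma padic_rel_refl: "padic_Cauchy p X \<Longrightarrow> padic_rel p X X"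
  by (simp add: padic_rel_def)

instantiation padic :: (prime_card) field
begin

lift_definition zero_padic :: "'a padic" is "\<lambda>n. 0"
  by (simp add: padic_rel_refl)

lift_definition one_padic :: "'a padic" is "\<lambda>n. 1"
  by (simp add: padic_rel_refl)

lift_definition plus_padic :: "'a padic \<Rightarrow> 'a padic \<Rightarrow> 'a padic" is "\<lambda>X Y n. X n + Y n"
  unfolding padic_rel_def add_diff_add
  by (simp add: padic_Cauchy_add padic_null_add prime_card)

lift_definition uminus_padic :: "'a padic \<Rightarrow> 'a padic" is "\<lambda>X n. - X n"
  unfolding padic_rel_def minus_diff_minus
  by (simp add: padic_Cauchy_minus padic_null_minus prime_card del: minus_diff_eq)

lift_definition times_padic :: "'a padic \<Rightarrow> 'a padic \<Rightarrow> 'a padic" is "\<lambda>X Y n. X n * Y n"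
proof -
  fix X X' Y Y' assume *: "padic_rel CARD('a) X X'" "padic_rel CARD('a) Y Y'"
  have "padic_null CARD('a) (\<lambda>n. X n * (Y n - Y' n) + Y' n * (X n - X' n))"
    using * by (intro padic_null_add padic_null_mult prime_card) (auto simp: padic_rel_def)
  moreover have "(\<lambda>n. X n * (Y n - Y' n) + Y' n * (X n - X' n)) = (\<lambda>n. X n * Y n - X' n * Y' n)"
    by (auto simp: algebra_simps)
  ultimately show "padic_rel CARD('a) (\<lambda>n. X n * Y n) (\<lambda>n. X' n * Y' n)"
    using * by (simp add: padic_rel_def padic_Cauchy_mult prime_card)
qed

lift_definition inverse_padic :: "'a padic \<Rightarrow> 'a padic"
  is "\<lambda>X. if padic_null CARD('a) X then (\<lambda>n. 0) else (\<lambda>n. inverse (X n))"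
proof -
  fix X Y assume *: "padic_rel CARD('a) X Y"
  show "padic_rel CARD('a) (if padic_null CARD('a) X then (\<lambda>n. 0) else (\<lambda>n. inverse (X n)))
      (if padic_null CARD('a) Y then (\<lambda>n. 0) else (\<lambda>n. inverse (Y n)))"
    using * padic_rel_null_iff[OF prime_card *]
    by (auto simp: padic_rel_def padic_Cauchy_inverse padic_null_diff_inverse prime_card)
qed

definition "x - y = x + - y" for x y :: "'a padic"

definition "x div y = x * inverse y" for x y :: "'a padic"

instance
proof
  fix a b c :: "'a padic"
  show "a + b = b + a"
    by transfer (simp add: ac_simps padic_rel_def padic_Cauchy_add prime_card)
  show "(a + b) + c = a + (b + c)"
    by transfer (simp add: ac_simps padic_rel_def padic_Cauchy_add prime_card)
  show "0 + a = a"
    by transfer (simp add: padic_rel_def)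
  show "- a + a = 0"
    by transfer (simp add: padic_rel_def)
  show "a - b = a + - b"
    by (rule minus_padic_def)
  show "(a * b) * c = a * (b * c)"
    by transfer (simp add: ac_simps padic_rel_def padic_Cauchy_mult prime_card)
  show "a * b = b * a"
    by transfer (simp add: ac_simps padic_rel_def padic_Cauchy_mult prime_card)
  show "1 * a = a"
    by transfer (simp add: padic_rel_def)
  show "(a + b) * c = a * c + b * c"
    by transfer (simp add: distrib_right padic_rel_def padic_Cauchy_add padic_Cauchy_mult prime_card)
  show "(0 :: 'a padic) \<noteq> 1"
    by transfer (simp add: padic_rel_def prime_card)
  have "padic_null CARD('a) (\<lambda>n. inverse (X n) * X n - 1)"
    if X: "padic_Cauchy CARD('a) X" "\<not> padic_null CARD('a) X" for X
  proof -
    obtain d N where "d > 0" and N: "\<And>n. n \<ge> N \<Longrightarrow> rat_padic_abs CARD('a) (X n) > d"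
      using padic_Cauchy_not_null[OF prime_card X] by blast
    have "eventually (\<lambda>n. 0 = rat_padic_abs CARD('a) (inverse (X n) * X n - 1)) sequentially"
      unfolding eventually_sequentially
    proof (intro exI[of _ N] allI impI)
      fix n assume "n \<ge> N"
      hence "X n \<noteq> 0" using N[of n] \<open>d > 0\<close> by auto
      thus "0 = rat_padic_abs CARD('a) (inverse (X n) * X n - 1)" by simp
    qed
    thus ?thesis unfolding padic_null_def by (rule Lim_transform_eventually[OF tendsto_const])
  qed
  thus "a \<noteq> 0 \<Longrightarrow> inverse a * a = 1"
    by transfer (simp add: padic_rel_def padic_Cauchy_mult padic_Cauchy_inverse prime_card)
  show "a div b = a * inverse b"
    by (rule divide_padic_def)
  show "inverse (0 :: 'a padic) = 0"
    by transfer (simp add: padic_rel_def)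
qed

end

section \<open>The p-adic absolute value\<close>

text \<open>
  The constant \<open>norm\<close> is restricted to real normed vector spaces, so the absolute value gets a name
  of its own; it induces the metric and the topology of the type.
\<close>

lift_definition padic_abs :: "'p::prime_card padic \<Rightarrow> real" is
  "\<lambda>X. lim (\<lambda>n. rat_padic_abs CARD('p) (X n))"
  by (rule padic_rel_lim) (rule prime_card)

lemma Padic_cases:
  obtains X where "padic_Cauchy CARD('p) X" "x = (Padic X :: 'p::prime_card padic)"
  using Quotient_rep_reflp[OF Quotient_padic, of x] Quotient_abs_rep[OF Quotient_padic, of x]
  by (metis padic_rel_def)

lemma eq_Padic:
  assumes "padic_Cauchy CARD('p) X" "padic_Cauchy CARD('p) Y"
  shows "Padic X = (Padic Y :: 'p::prime_card padic) \<longleftrightarrow> padic_null CARD('p) (\<lambda>n. X n - Y n)"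
  using Quotient_rel[OF Quotient_padic[where 'p = 'p], of X Y] assms by (auto simp: padic_rel_def)

lemma zero_Padic: "(0 :: 'p::prime_card padic) = Padic (\<lambda>n. 0)"
  using zero_padic.transfer[where 'a = 'p] by (simp add: cr_padic_eq)

lemma one_Padic: "(1 :: 'p::prime_card padic) = Padic (\<lambda>n. 1)"
  using one_padic.transfer[where 'a = 'p] by (simp add: cr_padic_eq)

lemma add_Padic:
  assumes "padic_Cauchy CARD('p) X" "padic_Cauchy CARD('p) Y"
  shows "Padic X + Padic Y = (Padic (\<lambda>n. X n + Y n) :: 'p::prime_card padic)"
  using plus_padic.transfer[where 'a = 'p] assms by (simp add: cr_padic_eq rel_fun_def)

lemma minus_Padic:
  assumes "padic_Cauchy CARD('p) X"
  shows "- Padic X = (Padic (\<lambda>n. - X n) :: 'p::prime_card padic)"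
  using uminus_padic.transfer[where 'a = 'p] assms by (simp add: cr_padic_eq rel_fun_def)

lemma diff_Padic:
  assumes "padic_Cauchy CARD('p) X" "padic_Cauchy CARD('p) Y"
  shows "Padic X - Padic Y = (Padic (\<lambda>n. X n - Y n) :: 'p::prime_card padic)"
  using assms by (simp add: minus_padic_def minus_Padic add_Padic padic_Cauchy_minus prime_card)

lemma mult_Padic:
  assumes "padic_Cauchy CARD('p) X" "padic_Cauchy CARD('p) Y"
  shows "Padic X * Padic Y = (Padic (\<lambda>n. X n * Y n) :: 'p::prime_card padic)"
  using times_padic.transfer[where 'a = 'p] assms by (simp add: cr_padic_eq rel_fun_def)

lemma tendsto_padic_abs_Padic:
  assumes "padic_Cauchy CARD('p) X"
  shows "(\<lambda>n. rat_padic_abs CARD('p) (X n)) \<longlonglongrightarrow> padic_abs (Padic X :: 'p::prime_card padic)"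
proof -
  have "padic_abs (Padic X :: 'p padic) = lim (\<lambda>n. rat_padic_abs CARD('p) (X n))"
    using padic_abs.transfer[where 'p = 'p] assms by (simp add: cr_padic_eq rel_fun_def)
  thus ?thesis using padic_Cauchy_abs_lim[OF prime_card assms] by simp
qed

lemma padic_abs_nonneg [simp]: "padic_abs (x :: 'p::prime_card padic) \<ge> 0"
proof -
  obtain X where X: "padic_Cauchy CARD('p) X" "x = Padic X" by (rule Padic_cases)
  show ?thesis
    unfolding X(2) by (rule LIMSEQ_le_const[OF tendsto_padic_abs_Padic[OF X(1)]]) (simp add: prime_card)
qed

lemma padic_abs_eq_0_iff [simp]: "padic_abs (x :: 'p::prime_card padic) = 0 \<longleftrightarrow> x = 0"
proof -
  obtain X where X: "padic_Cauchy CARD('p) X" "x = Padic X" by (rule Padic_cases)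
  have "padic_abs x = 0 \<longleftrightarrow> padic_null CARD('p) X"
    using tendsto_padic_abs_Padic[OF X(1)] X(2) LIMSEQ_unique unfolding padic_null_def by metis
  thus ?thesis using X by (simp add: zero_Padic eq_Padic)
qed

lemma padic_abs_0 [simp]: "padic_abs (0 :: 'p::prime_card padic) = 0"
  by simp

lemma padic_abs_mult: "padic_abs (x * y) = padic_abs x * padic_abs (y :: 'p::prime_card padic)"
proof -
  obtain X where X: "padic_Cauchy CARD('p) X" "x = Padic X" by (rule Padic_cases)
  obtain Y where Y: "padic_Cauchy CARD('p) Y" "y = Padic Y" by (rule Padic_cases)
  have "(\<lambda>n. rat_padic_abs CARD('p) (X n * Y n)) \<longlonglongrightarrow> padic_abs x * padic_abs y"
    unfolding rat_padic_abs_mult[OF prime_card] X(2) Y(2)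
    by (intro tendsto_mult tendsto_padic_abs_Padic X Y)
  moreover have "(\<lambda>n. rat_padic_abs CARD('p) (X n * Y n)) \<longlonglongrightarrow> padic_abs (x * y)"
    unfolding X(2) Y(2) mult_Padic[OF X(1) Y(1)]
    by (intro tendsto_padic_abs_Padic padic_Cauchy_mult prime_card X Y)
  ultimately show ?thesis using LIMSEQ_unique by blast
qed

lemma padic_abs_minus [simp]: "padic_abs (- x) = padic_abs (x :: 'p::prime_card padic)"
proof -
  obtain X where X: "padic_Cauchy CARD('p) X" "x = Padic X" by (rule Padic_cases)
  have "(\<lambda>n. rat_padic_abs CARD('p) (- X n)) \<longlonglongrightarrow> padic_abs (- x)"
    unfolding X(2) minus_Padic[OF X(1)]
    by (intro tendsto_padic_abs_Padic padic_Cauchy_minus prime_card X)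
  thus ?thesis using tendsto_padic_abs_Padic[OF X(1)] X(2) LIMSEQ_unique
    by (simp add: rat_padic_abs_minus[OF prime_card]) blast
qed

lemma padic_abs_minus_commute: "padic_abs (x - y) = padic_abs (y - x :: 'p::prime_card padic)"
  using padic_abs_minus[of "x - y"] by simp

lemma padic_abs_add_le: "padic_abs (x + y) \<le> max (padic_abs x) (padic_abs (y :: 'p::prime_card padic))"
proof -
  obtain X where X: "padic_Cauchy CARD('p) X" "x = Padic X" by (rule Padic_cases)
  obtain Y where Y: "padic_Cauchy CARD('p) Y" "y = Padic Y" by (rule Padic_cases)
  have "(\<lambda>n. rat_padic_abs CARD('p) (X n + Y n)) \<longlonglongrightarrow> padic_abs (x + y)"
    unfolding X(2) Y(2) add_Padic[OF X(1) Y(1)]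
    by (intro tendsto_padic_abs_Padic padic_Cauchy_add prime_card X Y)
  moreover have "(\<lambda>n. max (rat_padic_abs CARD('p) (X n)) (rat_padic_abs CARD('p) (Y n)))
      \<longlonglongrightarrow> max (padic_abs x) (padic_abs y)"
    unfolding X(2) Y(2) by (intro tendsto_max tendsto_padic_abs_Padic X Y)
  ultimately show ?thesis
    by (rule LIMSEQ_le) (simp add: rat_padic_abs_add_le[OF prime_card])
qed

lemma padic_abs_triangle: "padic_abs (x + y) \<le> padic_abs x + padic_abs (y :: 'p::prime_card padic)"
  using padic_abs_add_le[of x y] padic_abs_nonneg[of x] padic_abs_nonneg[of y] by linarith

lemma padic_abs_add_eq:
  assumes "padic_abs x < padic_abs y"
  shows "padic_abs (x + y) = padic_abs y"
  using assms padic_abs_add_le[of x y] padic_abs_add_le[of "x + y" "- x"] by simp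

instantiation padic :: (prime_card) metric_space
begin

definition dist_padic :: "'a padic \<Rightarrow> 'a padic \<Rightarrow> real" where
  "dist_padic x y = padic_abs (x - y)"

definition uniformity_padic :: "('a padic \<times> 'a padic) filter" where
  "uniformity_padic = (INF e\<in>{0<..}. principal {(x, y). dist x y < e})"

definition open_padic :: "'a padic set \<Rightarrow> bool" where
  "open_padic U \<longleftrightarrow> (\<forall>x\<in>U. \<forall>\<^sub>F (x', y) in uniformity. x' = x \<longrightarrow> y \<in> U)"

instance
proof
  fix x y z :: "'a padic"
  show "dist x y = 0 \<longleftrightarrow> x = y" by (simp add: dist_padic_def)
  show "dist x y \<le> dist x z + dist y z"
    using padic_abs_triangle[of "x - z" "z - y"] padic_abs_minus_commute[of y z]
    by (simp add: dist_padic_def)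
qed (simp_all add: uniformity_padic_def open_padic_def)

end

section \<open>The rationals are dense, and the p-adic numbers are complete\<close>

lemma of_nat_Padic: "of_nat k = (Padic (\<lambda>n. of_nat k) :: 'p::prime_card padic)"
  by (induction k) (simp_all add: zero_Padic one_Padic add_Padic)

instance padic :: (prime_card) field_char_0
proof
  show "inj (of_nat :: nat \<Rightarrow> 'a padic)"
    by (rule injI) (simp add: of_nat_Padic eq_Padic prime_card)
qed

lemma of_rat_Padic: "of_rat q = (Padic (\<lambda>n. q) :: 'p::prime_card padic)"
proof -
  have int: "of_int k = (Padic (\<lambda>n. of_int k) :: 'p padic)" for k
    by (cases k) (simp_all add: of_nat_Padic one_Padic diff_Padic minus_Padic add_Padic)
  obtain u v where uv: "quotient_of q = (u, v)" by fastforce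
  have v: "v \<noteq> 0" using quotient_of_denom_pos[OF uv] by simp
  have q: "q = of_int u / of_int v" by (rule quotient_of_div[OF uv])
  have "(Padic (\<lambda>n. q) :: 'p padic) * of_int v = of_int u"
    using v by (simp add: int mult_Padic q)
  thus ?thesis using v by (simp add: q of_rat_divide field_simps)
qed

lemma padic_abs_of_rat: "padic_abs (of_rat q :: 'p::prime_card padic) = rat_padic_abs CARD('p) q"
  using tendsto_padic_abs_Padic[of "\<lambda>n. q", where 'p = 'p] by (simp add: of_rat_Padic LIMSEQ_const_iff)

lemma padic_of_rat_dense:
  assumes "e > 0"
  obtains q where "dist x (of_rat q :: 'p::prime_card padic) < e"
proof -
  obtain X where X: "padic_Cauchy CARD('p) X" "x = Padic X" by (rule Padic_cases)
  have "e / 2 > 0" using assms by simp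
  then obtain N where N: "\<And>m n. m \<ge> N \<Longrightarrow> n \<ge> N \<Longrightarrow> rat_padic_abs CARD('p) (X m - X n) < e / 2"
    using X(1) unfolding padic_Cauchy_def by meson
  have C: "padic_Cauchy CARD('p) (\<lambda>n. X n - X N)"
    using padic_Cauchy_add[OF prime_card X(1) padic_Cauchy_const[of _ "- X N"]] by simp
  have "dist x (of_rat (X N)) = padic_abs (Padic (\<lambda>n. X n - X N) :: 'p padic)"
    by (simp add: dist_padic_def of_rat_Padic X diff_Padic)
  also have "\<dots> \<le> e / 2"
    by (rule LIMSEQ_le_const2[OF tendsto_padic_abs_Padic[OF C]]) (use N less_imp_le in blast)
  also have "\<dots> < e" using assms by simp
  finally show ?thesis by (rule that)
qed

instance padic :: (prime_card) complete_space
proof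
  fix Y :: "nat \<Rightarrow> 'a padic" assume Y: "Cauchy Y"
  have "\<exists>q. dist (Y n) (of_rat q) < 1 / real (Suc n)" for n
    by (rule padic_of_rat_dense[of "1 / real (Suc n)" "Y n"]) auto
  then obtain q where q: "\<And>n. dist (Y n) (of_rat (q n)) < 1 / real (Suc n)" by metis
  have lim0: "(\<lambda>n. dist (Y n) (of_rat (q n))) \<longlonglongrightarrow> 0"
    by (rule Lim_null_comparison[OF _ LIMSEQ_inverse_real_of_nat])
       (use q in \<open>simp add: inverse_eq_divide less_imp_le\<close>)
  have C: "padic_Cauchy CARD('a) q"
    unfolding padic_Cauchy_def
  proof (intro allI impI)
    fix e :: real assume "e > 0"
    hence e: "e / 3 > 0" by simp
    obtain M where M: "\<And>m n. m \<ge> M \<Longrightarrow> n \<ge> M \<Longrightarrow> dist (Y m) (Y n) < e / 3"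
      using metric_CauchyD[OF Y e] by blast
    obtain N where N: "\<And>n. n \<ge> N \<Longrightarrow> dist (Y n) (of_rat (q n)) < e / 3"
      using order_tendstoD(2)[OF lim0 e] by (auto simp: eventually_sequentially)
    show "\<exists>N. \<forall>m\<ge>N. \<forall>n\<ge>N. rat_padic_abs CARD('a) (q m - q n) < e"
    proof (intro exI[of _ "max M N"] allI impI)
      fix m n assume mn: "m \<ge> max M N" "n \<ge> max M N"
      have "rat_padic_abs CARD('a) (q m - q n) = dist (of_rat (q m) :: 'a padic) (of_rat (q n))"
        by (simp add: dist_padic_def padic_abs_of_rat flip: of_rat_diff)
      also have "\<dots> \<le> dist (Y m) (of_rat (q m)) + dist (Y m) (Y n) + dist (Y n) (of_rat (q n))"
        using dist_triangle2[of "of_rat (q m)" "of_rat (q n)" "Y m"]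
          dist_triangle[of "Y m" "of_rat (q n)" "Y n"]
          dist_triangle[of "of_rat (q m)" "of_rat (q n)" "Y m"] dist_commute[of "Y m" "of_rat (q m)"]
        by linarith
      also have "\<dots> < e" using M[of m n] N[of m] N[of n] mn by auto
      finally show "rat_padic_abs CARD('a) (q m - q n) < e" .
    qed
  qed
  have "(\<lambda>n. dist (of_rat (q n)) (Padic q :: 'a padic)) \<longlonglongrightarrow> 0"
  proof (rule LIMSEQ_I)
    fix e :: real assume "e > 0"
    hence e: "e / 2 > 0" by simp
    then obtain N where N: "\<And>m n. m \<ge> N \<Longrightarrow> n \<ge> N \<Longrightarrow> rat_padic_abs CARD('a) (q m - q n) < e / 2"
      using C unfolding padic_Cauchy_def by meson
    have "dist (of_rat (q n)) (Padic q :: 'a padic) < e" if "n \<ge> N" for n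
    proof -
      have Cn: "padic_Cauchy CARD('a) (\<lambda>m. q n - q m)"
        using padic_Cauchy_add[OF prime_card padic_Cauchy_const[of _ "q n"]
            padic_Cauchy_minus[OF prime_card C]] by simp
      have "dist (of_rat (q n)) (Padic q :: 'a padic) = padic_abs (Padic (\<lambda>m. q n - q m) :: 'a padic)"
        by (simp only: dist_padic_def of_rat_Padic diff_Padic[OF padic_Cauchy_const C])
      also have "\<dots> \<le> e / 2"
        by (rule LIMSEQ_le_const2[OF tendsto_padic_abs_Padic[OF Cn]]) (use N that less_imp_le in blast)
      also have "\<dots> < e" using \<open>e > 0\<close> by simp
      finally show ?thesis .
    qed
    thus "\<exists>N. \<forall>n\<ge>N. norm (dist (of_rat (q n)) (Padic q :: 'a padic) - 0) < e" by auto
  qed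
  from tendsto_add_zero[OF lim0 this]
  have "(\<lambda>n. dist (Y n) (of_rat (q n)) + dist (of_rat (q n)) (Padic q :: 'a padic)) \<longlonglongrightarrow> 0" .
  hence "(\<lambda>n. dist (Y n) (Padic q)) \<longlonglongrightarrow> 0"
    by (rule Lim_null_comparison[rotated]) (simp add: dist_triangle)
  hence "Y \<longlonglongrightarrow> Padic q" by (rule iffD2[OF tendsto_dist_iff])
  thus "convergent Y" by (rule convergentI)
qed

lemma mem_sphere_0_padic [simp]: "x \<in> sphere 0 r \<longleftrightarrow> padic_abs (x :: 'p::prime_card padic) = r"
  by (simp add: dist_padic_def)

section \<open>Derivatives\<close>

text \<open>
  The library's derivatives require a real normed field; over a general topological field the
  derivative is the limit of the difference quotients.
\<close>

definition has_top_field_deriv ::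
  "('a::{field, topological_space} \<Rightarrow> 'a) \<Rightarrow> 'a \<Rightarrow> 'a \<Rightarrow> bool" where
  "has_top_field_deriv f D x \<longleftrightarrow> ((\<lambda>h. (f (x + h) - f x) / h) \<longlongrightarrow> D) (at 0)"

definition top_field_differentiable ::
  "('a::{field, topological_space} \<Rightarrow> 'a) \<Rightarrow> 'a \<Rightarrow> bool" where
  "top_field_differentiable f x \<longleftrightarrow> (\<exists>D. has_top_field_deriv f D x)"

definition top_field_deriv ::
  "('a::{field, topological_space} \<Rightarrow> 'a) \<Rightarrow> 'a \<Rightarrow> 'a" where
  "top_field_deriv f x = (THE D. has_top_field_deriv f D x)"

text \<open>The limit is unique because \<open>0\<close> is not isolated: the powers of \<open>p\<close> tend to \<open>0\<close>.\<close>

instance padic :: (prime_card) perfect_space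
proof
  fix x :: "'a padic"
  show "\<not> open {x}"
  proof
    assume "open {x}"
    then obtain e where e: "e > 0" "\<And>y. dist y x < e \<Longrightarrow> y = x"
      by (auto simp: open_dist)
    let ?p = "of_nat CARD('a) :: rat"
    have p: "prime CARD('a)" by (rule prime_card)
    have p1: "CARD('a) > 1" by (rule prime_gt_1_nat[OF p])
    have "prime_elem (int CARD('a))" using p by simp
    hence "multiplicity (int CARD('a)) (int CARD('a)) = 1"
      by (intro multiplicity_self) auto
    hence np: "rat_padic_abs CARD('a) ?p = inverse (real CARD('a))"
      using rat_padic_abs_frac[OF p, of "int CARD('a)" 1] p1 by (simp add: power_int_minus)
    have pow: "rat_padic_abs CARD('a) (?p ^ n) = inverse (real CARD('a)) ^ n" for n
      by (induction n) (simp_all add: rat_padic_abs_mult p np)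
    have "(\<lambda>n. inverse (real CARD('a)) ^ n) \<longlonglongrightarrow> 0"
      using p1 by (intro LIMSEQ_power_zero) (simp add: field_simps)
    then obtain n where "inverse (real CARD('a)) ^ n < e"
      using order_tendstoD(2)[OF _ e(1)] by (metis eventually_sequentially order_refl)
    hence "dist (x + of_rat (?p ^ n)) x < e"
      by (simp add: dist_padic_def padic_abs_of_rat pow del: of_rat_power of_rat_of_nat_eq)
    hence "of_rat (?p ^ n) = (0 :: 'a padic)" using e(2) by fastforce
    thus False using p1 by simp
  qed
qed

lemma top_field_deriv_eq:
  "has_top_field_deriv f D x \<Longrightarrow> top_field_deriv f x = (D :: 'p::prime_card padic)"
  unfolding top_field_deriv_def has_top_field_deriv_def
  using tendsto_unique[OF trivial_limit_at] by blast

section \<open>The rational function and the set of radii\<close>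

text \<open>The value at the pole \<open>- b / a\<close> is a dummy value; the function is only considered elsewhere.\<close>

definition rat_fun :: "'a::field \<Rightarrow> 'a \<Rightarrow> 'a \<Rightarrow> 'a" where
  "rat_fun a b x = (x ^ 3 + a * x ^ 2 + b * x) / (a * x + b)"

definition radii :: "real \<Rightarrow> real \<Rightarrow> real \<Rightarrow> real set" where
  "radii \<alpha> \<beta> \<delta> = {r. (\<delta> \<le> \<alpha> \<and> \<alpha> = \<beta> \<and> 0 < r \<and> r < \<alpha>)
                  \<or> (\<alpha> < \<beta> \<and> \<beta> = \<delta> \<and> 0 < r \<and> r < \<beta> \<and> r \<noteq> \<alpha>)}"

text \<open>One of the two cases always applies, and they exclude each other:\<close>

lemma radii_cases:
  fixes a s x1 x2 :: "'p::prime_card padic"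
  assumes "{x1, x2} = {(- a + s) / 2, (- a - s) / 2}" and "padic_abs x1 \<le> padic_abs x2"
  shows "padic_abs a \<le> padic_abs x1 \<and> padic_abs x1 = padic_abs x2
       \<or> padic_abs x1 < padic_abs x2 \<and> padic_abs x2 = padic_abs a"
proof -
  have "x1 + x2 = (- a + s) / 2 + (- a - s) / 2"
    using assms(1) unfolding doubleton_eq_iff by (metis add.commute)
  also have "\<dots> = - a" by (simp add: field_simps)
  finally have "padic_abs (x1 + x2) = padic_abs a" by simp
  thus ?thesis
    using assms(2) padic_abs_add_le[of x1 x2] padic_abs_add_eq[of x1 x2] by fastforce
qed

end

theory Submission
  imports Defs
begin

text \<open>
  With \<open>D = a x + b\<close> one has \<open>f' x = 1 + x\<^sup>2 (2 a x + 3 b) / D\<^sup>2\<close>. Since \<open>b = x1 x2\<close>, for a radius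
  \<open>r \<in> radii \<alpha> \<beta> \<delta>\<close> the two terms of \<open>D\<close> have the distinct absolute values \<open>\<delta> r\<close> and \<open>\<alpha> \<beta>\<close>, so
  \<open>\<bar>D\<bar> = max (\<delta> r) (\<alpha> \<beta>)\<close>, which exceeds \<open>r\<^sup>2\<close>; as \<open>\<bar>2 a x + 3 b\<bar> \<le> \<bar>D\<bar>\<close>, the correction to \<open>1\<close> has
  absolute value less than \<open>1\<close>.
\<close>

lemma padic_abs_add_eq_max:
  fixes x y :: "'p::prime_card padic"
  assumes "padic_abs x \<noteq> padic_abs y"
  shows "padic_abs (x + y) = max (padic_abs x) (padic_abs y)"
  using assms padic_abs_add_eq[of x y] padic_abs_add_eq[of y x] by (auto simp: max_def add.commute)

lemma padic_abs_1 [simp]: "padic_abs (1 :: 'p::prime_card padic) = 1"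
  using padic_abs_mult[of "1 :: 'p padic" 1] by simp

lemma padic_abs_divide:
  fixes x y :: "'p::prime_card padic"
  shows "padic_abs (x / y) = padic_abs x / padic_abs y"
proof (cases "y = 0")
  case False
  hence "padic_abs (x / y) * padic_abs y = padic_abs x"
    by (simp flip: padic_abs_mult)
  thus ?thesis using False by (simp add: field_simps)
qed simp

lemma padic_abs_power: "padic_abs (x ^ n) = padic_abs (x :: 'p::prime_card padic) ^ n"
  by (induction n) (simp_all add: padic_abs_mult)

lemma tendsto_padic_abs_at_0: "((\<lambda>h. padic_abs h) \<longlongrightarrow> 0) (at (0 :: 'p::prime_card padic))"
  using tendsto_dist_iff[of "\<lambda>h. h" "0 :: 'p padic" "at 0"] by (simp add: dist_padic_def)

text \<open>Squeezing against \<open>C * padic_abs h\<close> turns the limit of difference quotients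
  into an algebraic estimate near 0.\<close>

lemma has_top_field_deriv_padicI:
  fixes D x :: "'p::prime_card padic"
  assumes "\<forall>\<^sub>F h in at 0. padic_abs ((f (x + h) - f x) / h - D) \<le> C * padic_abs h"
  shows "has_top_field_deriv f D x"
  unfolding has_top_field_deriv_def tendsto_dist_iff[of _ D]
proof (rule Lim_null_comparison)
  show "\<forall>\<^sub>F h in at 0. norm (dist ((f (x + h) - f x) / h) D) \<le> C * padic_abs h"
    using assms by (simp add: dist_padic_def)
  show "((\<lambda>h. C * padic_abs h) \<longlongrightarrow> 0) (at (0 :: 'p padic))"
    using tendsto_mult_right_zero[OF tendsto_padic_abs_at_0] .
qed

text \<open>Computed from the difference quotient itself: its error is \<open>h\<close> times a
  fraction that stays bounded near 0.\<close>

lemma has_top_field_deriv_rat_fun: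
  fixes a b x :: "'p::prime_card padic"
  assumes "a * x + b \<noteq> 0"
  shows "has_top_field_deriv (rat_fun a b) (1 + x\<^sup>2 * (2 * a * x + 3 * b) / (a * x + b)\<^sup>2) x"
proof -
  define D where "D = a * x + b"
  \<comment> \<open>\<open>G\<close> is the numerator of the quotient rule over
    \<open>D\<^sup>2\<close>, rearranged; \<open>M\<close> bounds the cofactor of \<open>h\<close>
    in the error once \<open>padic_abs h < 1\<close>.\<close>
  define G where "G = D\<^sup>2 + x\<^sup>2 * (2 * a * x + 3 * b)"
  define M where "M = padic_abs ((3 * x + a) * D\<^sup>2 - a * G) + padic_abs (D\<^sup>2)"
  have D: "D \<noteq> 0" using assms by (simp add: D_def)
  have "\<forall>\<^sub>F h in at 0. padic_abs h < 1"
    by (rule order_tendstoD(2)[OF tendsto_padic_abs_at_0]) simp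
  \<comment> \<open>Under this condition the shifted denominator \<open>D + a * h\<close> keeps the
    absolute value of \<open>D\<close>, so it avoids the pole and needs no separate lower
    bound.\<close>
  moreover have "\<forall>\<^sub>F h in at 0. padic_abs (a * h) < padic_abs D"
    using order_tendstoD(2)[OF tendsto_mult_right_zero[OF tendsto_padic_abs_at_0, of "padic_abs a"],
        of "padic_abs D"] D by (simp add: padic_abs_mult less_le)
  moreover have "\<forall>\<^sub>F h in at (0 :: 'p padic). h \<noteq> 0" by (simp add: eventually_at_filter)
  ultimately have "\<forall>\<^sub>F h in at 0. padic_abs ((rat_fun a b (x + h) - rat_fun a b x) / h - G / D\<^sup>2)
      \<le> M / padic_abs D ^ 3 * padic_abs h"
  proof eventually_elim
    case (elim h)
    have Dh: "padic_abs (a * (x + h) + b) = padic_abs D"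
      using padic_abs_add_eq[OF elim(2)] by (simp add: D_def algebra_simps)
    hence Dh0: "a * (x + h) + b \<noteq> 0" using D by (metis padic_abs_eq_0_iff)
    have "(rat_fun a b (x + h) - rat_fun a b x) / h - G / D\<^sup>2
        = ((3 * x + a) * D\<^sup>2 - a * G + h * D\<^sup>2) / (D\<^sup>2 * (a * (x + h) + b)) * h"
    proof -
      have "rat_fun a b (x + h) - rat_fun a b x
          = (((x + h) ^ 3 + a * (x + h)\<^sup>2 + b * (x + h)) * D
              - (x ^ 3 + a * x\<^sup>2 + b * x) * (a * (x + h) + b)) / ((a * (x + h) + b) * D)"
        using D Dh0 by (simp add: rat_fun_def D_def diff_frac_eq)
      also have "((x + h) ^ 3 + a * (x + h)\<^sup>2 + b * (x + h)) * D
              - (x ^ 3 + a * x\<^sup>2 + b * x) * (a * (x + h) + b) = h * (G + h * (3 * x + a + h) * D)"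
        unfolding G_def D_def by (simp add: algebra_simps power2_eq_square power3_eq_cube)
      finally have "(rat_fun a b (x + h) - rat_fun a b x) / h - G / D\<^sup>2
          = (G + h * (3 * x + a + h) * D) / ((a * (x + h) + b) * D) - G / D\<^sup>2"
        using elim(3) by simp
      also have "\<dots> = ((G + h * (3 * x + a + h) * D) * D - G * (a * (x + h) + b))
          / (D\<^sup>2 * (a * (x + h) + b))"
        using D Dh0 by (simp add: divide_simps power2_eq_square)
      \<comment> \<open>Since \<open>a * (x + h) + b = D + a * h\<close>, the terms
        \<open>G * D\<close> cancel and a factor \<open>h\<close> remains.\<close>
      also have "(G + h * (3 * x + a + h) * D) * D - G * (a * (x + h) + b)
          = ((3 * x + a) * D\<^sup>2 - a * G + h * D\<^sup>2) * h"
        unfolding D_def by (simp add: algebra_simps power2_eq_square)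
      finally show ?thesis by simp
    qed
    moreover have "padic_abs ((3 * x + a) * D\<^sup>2 - a * G + h * D\<^sup>2) \<le> M"
    proof -
      have "padic_abs (h * D\<^sup>2) \<le> padic_abs (D\<^sup>2)"
        using elim(1) by (simp add: padic_abs_mult mult_left_le_one_le)
      thus ?thesis
        using padic_abs_triangle[of "(3 * x + a) * D\<^sup>2 - a * G" "h * D\<^sup>2"] by (simp add: M_def)
    qed
    ultimately show ?case
      by (simp add: padic_abs_mult padic_abs_divide padic_abs_power Dh power3_eq_cube
          power2_eq_square mult_right_mono divide_right_mono del: times_divide_eq_left)
  qed
  from has_top_field_deriv_padicI[OF this] show ?thesis
    using D by (simp add: G_def D_def add_divide_distrib)
qed

text \<open>If \<alpha> = \<beta>, the product \<open>\<alpha> * \<beta>\<close> exceeds both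
  \<open>\<delta> * r\<close> and \<open>r\<^sup>2\<close>. If \<beta> = \<delta>, dividing by
  \<beta> reduces the first claim to r \<noteq> \<alpha>, and
  \<open>r\<^sup>2 < \<delta> * r\<close> follows from r < \<beta>.\<close>

lemma radii_bounds:
  assumes "r \<in> radii \<alpha> \<beta> \<delta>" "0 \<le> \<alpha>"
  shows "\<delta> * r \<noteq> \<alpha> * \<beta>" "r\<^sup>2 < max (\<delta> * r) (\<alpha> * \<beta>)"
proof -
  from assms consider "\<delta> \<le> \<alpha>" "\<alpha> = \<beta>" "0 < r" "r < \<alpha>" | "\<alpha> < \<beta>" "\<beta> = \<delta>" "0 < r" "r < \<beta>" "r \<noteq> \<alpha>"
    by (auto simp: radii_def)
  hence "\<delta> * r \<noteq> \<alpha> * \<beta> \<and> r\<^sup>2 < max (\<delta> * r) (\<alpha> * \<beta>)"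
  proof cases
    case 1
    have "\<delta> * r \<le> \<alpha> * r" "\<alpha> * r < \<alpha> * \<alpha>" "r * r < \<alpha> * \<alpha>"
      using 1 by (auto intro: mult_right_mono mult_strict_mono)
    hence "\<delta> * r < \<alpha> * \<beta>" "r * r < \<alpha> * \<beta>" unfolding 1(2) by linarith+
    thus ?thesis by (simp add: power2_eq_square)
  next
    case 2
    thus ?thesis by (auto simp: power2_eq_square less_max_iff_disj)
  qed
  thus "\<delta> * r \<noteq> \<alpha> * \<beta>" "r\<^sup>2 < max (\<delta> * r) (\<alpha> * \<beta>)" by auto
qed

text \<open>Differentiability is part of the conclusion because \<open>top_field_deriv\<close> is a
  definite description, informative only where a derivative exists; likewise \<open>rat_fun\<close>
  has a dummy value at the pole.\<close>

theorem theorem10: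
  fixes a b s x1 x2 x :: "'p::prime_card padic"
    and \<alpha> \<beta> \<delta> r :: real
  assumes "a * b \<noteq> 0"
    and "s ^ 2 = a ^ 2 - 4 * b"
    and "{x1, x2} = {(- a + s) / 2, (- a - s) / 2}"
    and "\<alpha> = padic_abs x1" and "\<beta> = padic_abs x2" and "\<alpha> \<le> \<beta>" and "\<delta> = padic_abs a"
    and "r \<in> radii \<alpha> \<beta> \<delta>"
    and "x \<in> sphere 0 r"
  shows "x \<noteq> - b / a \<and>
         top_field_differentiable (rat_fun a b) x \<and>
         padic_abs (top_field_deriv (rat_fun a b) x) = 1"
proof -
  let ?D = "a * x + b" and ?E = "x\<^sup>2 * (2 * a * x + 3 * b)"
  \<comment> \<open>Either labelling of the roots is possible, but the product is symmetric in
    them.\<close>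
  have "x1 * x2 = (- a + s) / 2 * ((- a - s) / 2)"
    using assms(3) unfolding doubleton_eq_iff by (metis mult.commute)
  also have "\<dots> = (a\<^sup>2 - s\<^sup>2) / 4" by (simp add: field_simps power2_eq_square)
  also have "\<dots> = b" using assms(2) by simp
  finally have "padic_abs b = \<alpha> * \<beta>" using assms(4,5) by (metis padic_abs_mult)
  moreover have r: "padic_abs x = r" using assms(9) by (simp only: mem_sphere_0_padic)
  moreover have ax: "padic_abs (a * x) = \<delta> * r" using assms(7) r by (simp add: padic_abs_mult)
  moreover have rb: "\<delta> * r \<noteq> \<alpha> * \<beta>" "r\<^sup>2 < max (\<delta> * r) (\<alpha> * \<beta>)"
    using radii_bounds[OF assms(8)] assms(4) by simp_all
  ultimately have D: "padic_abs ?D = max (\<delta> * r) (\<alpha> * \<beta>)" and b: "padic_abs b \<le> padic_abs ?D"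
    using padic_abs_add_eq_max[of "a * x" b] by simp_all
  \<comment> \<open>The strict bound above a square also shows \<open>?D \<noteq> 0\<close>, which
    keeps \<open>x\<close> off the pole.\<close>
  hence rD: "r\<^sup>2 < padic_abs ?D" using rb by simp
  hence D_pos: "padic_abs ?D > 0" using zero_le_power2[of r] by linarith
  hence D0: "?D \<noteq> 0" by force
  have a0: "a \<noteq> 0" using assms(1) by simp
  \<comment> \<open>Written as a sum of copies of \<open>?D\<close> and \<open>b\<close>, the term
    is bounded by the ultrametric inequality alone, uniformly in the prime, including 2 and
    3.\<close>
  have "2 * a * x + 3 * b = ?D + (?D + b)" by (simp add: algebra_simps)
  moreover have "padic_abs (?D + (?D + b)) \<le> padic_abs ?D"
    using b padic_abs_add_le[of ?D "?D + b"] padic_abs_add_le[of ?D b] by linarith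
  ultimately have "padic_abs (2 * a * x + 3 * b) \<le> padic_abs ?D" by metis
  hence "padic_abs ?E \<le> r\<^sup>2 * padic_abs ?D"
    by (simp add: padic_abs_mult padic_abs_power r mult_left_mono)
  also have "\<dots> < (padic_abs ?D)\<^sup>2"
    using rD D_pos by (simp add: power2_eq_square)
  finally have "padic_abs (?E / ?D\<^sup>2) < padic_abs 1"
    using D_pos by (simp add: padic_abs_divide padic_abs_power divide_less_eq_1)
  hence "padic_abs (1 + ?E / ?D\<^sup>2) = 1"
    using padic_abs_add_eq[of "?E / ?D\<^sup>2" 1] by (simp add: add.commute)
  moreover have "x \<noteq> - b / a" using D0 a0 by (auto simp: field_simps)
  ultimately show ?thesis
    using has_top_field_deriv_rat_fun[OF D0] top_field_deriv_eq[OF has_top_field_deriv_rat_fun[OF D0]]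
    by (auto simp: top_field_differentiable_def)
qed

end
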